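(* Let $0<m\le M$, $2\le p\le d$, $0<\tau\le\frac1{p-1}$, $0<\eta<\frac1d$ (with $\tau,\eta\le 1$), $T>0$ and the cluster index $\kappa\in\{1,\dots,d-p+1\}$ be fixed. There exist positive constants $C_1',\dots,C_5'$, depending only on $d,p,m,M$, such that for every $\Omega,h>0$ satisfying $h\le C_4'T$ and $\Omega h\le C_5'$ there exists $F=(\mathbf a,\mathbf x)\in\mathcal P_d$, with $\mathbf x$ forming a $(p,h,T,\tau,\eta)$-clustered configuration with cluster $\mathbf x^c=\{x_\kappa,\dots,x_{\kappa+p-1}\}$, and with $m\le|a_j|\le M$ for all $j=1,\dots,d$, such that for certain indices $j_1,j_2\in\{\kappa,\dots,\kappa+p-1\}$ and every $0<\epsilon\le C_3'(\Omega\tau h)^{2p-1}$ it holds that $$\operatorname{diam}\big(E^{\mathbf x,j}_{\epsilon,\Omega}(F)\big)\ge\frac{C_1'}{\Omega}\,\epsilon\times\begin{cases}(\Omega\tau h)^{-2p+2}, & \text{if } j=j_1,\\ 1, & \text{for all } j\notin\{\kappa,\dots,\kappa+p-1\},\end{cases}$$ $$\operatorname{diam}\big(E^{\mathbf a,j}_{\epsilon,\Omega}(F)\big)\ge C_2'\,\epsilon\times\begin{cases}(\Omega\tau h)^{-2p+1}, & \text{if } j=j_2,\\ 1, & \text{for all } j\notin\{\kappa,\dots,\kappa+p-1\}.\end{cases}$$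
   Context: $\mathcal P_d=\{(\mathbf a,\mathbf x):\mathbf a=(a_1,\dots,a_d)\in\mathbb C^d,\ \mathbf x=(x_1,\dots,x_d)\in\mathbb R^d,\ x_1<x_2<\dots<x_d\}$; an element $F=(\mathbf a,\mathbf x)$ is identified with the signal $F(x)=\sum_{j=1}^d a_j\delta(x-x_j)$, whose Fourier transform is $\mathcal F(F)(s)=\sum_{j=1}^d a_je^{-2\pi i x_js}$. Clustered configuration: given $0<\tau,\eta\le1$ and $0<h\le T$, a node vector $\mathbf x=(x_1,\dots,x_d)\in\mathbb R^d$ (with increasing entries) forms a $(p,h,T,\tau,\eta)$-clustered configuration if there is a subset of $p\ge2$ consecutive nodes $\mathbf x^c=\{x_\kappa,\dots,x_{\kappa+p-1}\}\subset\mathbf x$ such that (1) for all $x_j,x_k\in\mathbf x^c$, $j\ne k$: $\tau h\le|x_j-x_k|\le h$; (2) for all $x_\ell\in\mathbf x\setminus\mathbf x^c$ and $x_j\in\mathbf x$, $\ell\ne j$: $\eta T\le|x_\ell-x_j|\le T$. Error set: $E_{\epsilon,\Omega}(F)=\{F'\in\mathcal P_d:\ |\mathcal F(F')(s)-\mathcal F(F)(s)|\le\epsilon\ \text{for all } s\in[-\Omega,\Omega]\}$. Its coordinate projections are $E^{\mathbf x,j}_{\epsilon,\Omega}(F)=\{x_j'\in\mathbb R:(\mathbf a',\mathbf x')\in E_{\epsilon,\Omega}(F)\}$ and $E^{\mathbf a,j}_{\epsilon,\Omega}(F)=\{a_j'\in\mathbb C:(\mathbf a',\mathbf x')\in E_{\epsilon,\Omega}(F)\}$.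 For a subset $V$ of a normed space, $\operatorname{diam}(V)=\sup_{v',v''\in V}\|v'-v''\|$. *)

theory Defs
  imports "HOL-Analysis.Analysis"
begin

text \<open>A signal with \<open>d\<close> spikes is the pair of its amplitude vector in \<open>\<complex>\<^sup>d\<close> and its node vector in
  \<open>\<real>\<^sup>d\<close>.  Vectors are extensional functions on the index set \<open>{1..d}\<close>.\<close>

type_synonym signal = "(nat \<Rightarrow> complex) \<times> (nat \<Rightarrow> real)"

definition signals :: "nat \<Rightarrow> signal set" where
  "signals d = {(a, x). a \<in> {1..d} \<rightarrow>\<^sub>E UNIV \<and> x \<in> {1..d} \<rightarrow>\<^sub>E UNIV \<and> strict_mono_on {1..d} x}"

definition fourier :: "nat \<Rightarrow> signal \<Rightarrow> real \<Rightarrow> complex" where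
  "fourier d F s =
     (\<Sum>j=1..d. fst F j * exp (- 2 * complex_of_real pi * \<i> * complex_of_real (snd F j) * complex_of_real s))"

text \<open>The cluster consists of the nodes with indices \<open>\<kappa>, \<dots>, \<kappa> + p - 1\<close>.  The standing
  requirements on the parameters are part of the definition.  Since the nodes are strictly
  increasing, distinct nodes are the same as distinct indices.\<close>

definition clustered_configuration ::
  "nat \<Rightarrow> nat \<Rightarrow> real \<Rightarrow> real \<Rightarrow> real \<Rightarrow> real \<Rightarrow> nat \<Rightarrow> (nat \<Rightarrow> real) \<Rightarrow> bool" where
  "clustered_configuration d p h T \<tau> \<eta> \<kappa> x \<longleftrightarrow>
     0 < \<tau> \<and> \<tau> \<le> 1 \<and> 0 < \<eta> \<and> \<eta> \<le> 1 \<and> 0 < h \<and> h \<le> T \<and>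
     2 \<le> p \<and> 1 \<le> \<kappa> \<and> \<kappa> + p \<le> d + 1 \<and>
     strict_mono_on {1..d} x \<and>
     (\<forall>j\<in>{\<kappa>..<\<kappa> + p}. \<forall>k\<in>{\<kappa>..<\<kappa> + p}. j \<noteq> k \<longrightarrow>
        \<tau> * h \<le> \<bar>x j - x k\<bar> \<and> \<bar>x j - x k\<bar> \<le> h) \<and>
     (\<forall>l\<in>{1..d} - {\<kappa>..<\<kappa> + p}. \<forall>j\<in>{1..d}. l \<noteq> j \<longrightarrow>
        \<eta> * T \<le> \<bar>x l - x j\<bar> \<and> \<bar>x l - x j\<bar> \<le> T)"

definition error_set :: "nat \<Rightarrow> real \<Rightarrow> real \<Rightarrow> signal \<Rightarrow> signal set" where
  "error_set d \<epsilon> \<Omega> F =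
     {F' \<in> signals d. \<forall>s\<in>{-\<Omega>..\<Omega>}. cmod (fourier d F' s - fourier d F s) \<le> \<epsilon>}"

definition node_error_set :: "nat \<Rightarrow> real \<Rightarrow> real \<Rightarrow> nat \<Rightarrow> signal \<Rightarrow> real set" where
  "node_error_set d \<epsilon> \<Omega> j F = {x' j | a' x'. (a', x') \<in> error_set d \<epsilon> \<Omega> F}"

definition amplitude_error_set :: "nat \<Rightarrow> real \<Rightarrow> real \<Rightarrow> nat \<Rightarrow> signal \<Rightarrow> complex set" where
  "amplitude_error_set d \<epsilon> \<Omega> j F = {a' j | a' x'. (a', x') \<in> error_set d \<epsilon> \<Omega> F}"

text \<open>The library's real-valued \<open>diameter\<close> is unspecified on unbounded sets, and an error set may be
  unbounded; the supremum is therefore taken in \<open>[0, \<infinity>]\<close>.\<close>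

definition ediam :: "'a::real_normed_vector set \<Rightarrow> ennreal" where
  "ediam V = (SUP (v, w)\<in>V \<times> V. ennreal (norm (v - w)))"

end

theory Submission
  imports Defs
begin

text \<open>All amplitudes are \<open>m\<close> and the cluster is an equispaced grid of step \<open>\<Delta> = \<tau> h\<close>, rescaled to
  \<open>0, \<dots>, p - 1\<close>.  A second grid \<open>y\<^sub>0 < \<dots> < y\<^sub>p\<^sub>-\<^sub>1\<close> with amplitudes \<open>b\<^sub>k\<close> has the same moments
  of order at most \<open>2 p - 2\<close> as the first one with unit amplitudes iff
  \<open>\<Sum> b\<^sub>k f(y\<^sub>k) - \<Sum> f(k)\<close> is \<open>c\<close> times the divided difference of \<open>f\<close> at the \<open>2 p\<close> points;
  for \<open>f(y) = exp(-\<i> y s)\<close> this is at most \<open>c |s|\<^sup>2\<^sup>p\<^sup>-\<^sup>1\<close>.  With \<open>P(t) = \<Prod>(t - k)\<close> and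
  \<open>Q(t) = \<Prod>(t - y\<^sub>k)\<close> the condition reads \<open>P'(k) Q(k) = -c\<close>, that is, \<open>Q = P - c R\<close> where \<open>R\<close>
  interpolates \<open>1 / P'(k)\<close> at \<open>k\<close>.  For small \<open>c > 0\<close> this \<open>Q\<close> has a root slightly to the right of each
  \<open>k\<close>; prescribing the leftmost root \<open>y\<^sub>0 = v\<close> fixes \<open>c\<close>, of order \<open>v\<close>.  So the leftmost node moves by
  \<open>v\<close>, its amplitude grows by at least \<open>v\<close>, and the Fourier transform changes by
  \<open>O(v (\<Omega> \<Delta>)\<^sup>2\<^sup>p\<^sup>-\<^sup>1)\<close>.\<close>

section \<open>Divided differences of exponentials\<close>

text \<open>The explicit Lagrange-weight form of the divided difference. Indexing by a set restricts
  it to distinct points, and the weights can be read off directly as amplitudes later on.\<close>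

definition divided_difference :: "real set \<Rightarrow> (real \<Rightarrow> complex) \<Rightarrow> complex" where
  "divided_difference Y f = (\<Sum>y\<in>Y. f y / complex_of_real (\<Prod>z\<in>Y - {y}. y - z))"

text \<open>The factor \<open>y - v\<close> kills the term at \<open>v\<close> and cancels against
  the denominator of every other term.\<close>

lemma divided_difference_remove:
  assumes "finite Y" "v \<in> Y"
  shows "divided_difference (Y - {v}) f = divided_difference Y (\<lambda>y. complex_of_real (y - v) * f y)"
proof -
  have "divided_difference Y (\<lambda>y. complex_of_real (y - v) * f y)
      = (\<Sum>y\<in>Y - {v}. complex_of_real (y - v) * f y / complex_of_real (\<Prod>z\<in>Y - {y}. y - z))"
    unfolding divided_difference_def using assms by (intro sum.mono_neutral_right) auto
  also have "\<dots> = divided_difference (Y - {v}) f"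
    unfolding divided_difference_def
  proof (rule sum.cong)
    fix y assume y: "y \<in> Y - {v}"
    have "(\<Prod>z\<in>Y - {y}. y - z) = (y - v) * (\<Prod>z\<in>Y - {y} - {v}. y - z)"
      using assms y by (intro prod.remove) auto
    also have "Y - {y} - {v} = Y - {v} - {y}" by auto
    finally show "complex_of_real (y - v) * f y / complex_of_real (\<Prod>z\<in>Y - {y}. y - z)
        = f y / complex_of_real (\<Prod>z\<in>Y - {v} - {y}. y - z)"
      using y by simp
  qed simp
  finally show ?thesis by simp
qed

lemma divided_difference_const:
  assumes "finite Y" "2 \<le> card Y"
  shows "divided_difference Y (\<lambda>_. 1) = 0"
  using assms
proof (induction "card Y" arbitrary: Y rule: less_induct)
  case less
  obtain u v where uv: "u \<in> Y" "v \<in> Y" "u \<noteq> v"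
    using less.prems by (metis card_2_iff' obtain_subset_with_card_n subsetD)
  \<comment> \<open>Both sides are 1 when a single point is left and vanish by induction
    otherwise.\<close>
  have eq: "divided_difference (Y - {u}) (\<lambda>_. 1) = divided_difference (Y - {v}) (\<lambda>_. 1)"
  proof (cases "card Y = 2")
    case True
    have "Y = {u, v}"
      using True uv less.prems by (metis card_2_iff doubleton_eq_iff insert_iff singletonD)
    then have "Y - {u} = {v}" "Y - {v} = {u}" using uv by auto
    then show ?thesis by (simp add: divided_difference_def)
  next
    case False
    then show ?thesis using less uv by (simp add: card_Diff_singleton)
  qed
  \<comment> \<open>By the removal formula the two sides are compared through
    \<open>(y - v) - (y - u) = u - v\<close>, independent of \<open>y\<close>.\<close>
  have "divided_difference (Y - {v}) (\<lambda>_. 1) - divided_difference (Y - {u}) (\<lambda>_. 1)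
      = complex_of_real (u - v) * divided_difference Y (\<lambda>_. 1)"
    unfolding divided_difference_remove[OF less.prems(1) uv(1)]
      divided_difference_remove[OF less.prems(1) uv(2)]
    by (simp add: divided_difference_def sum_subtractf[symmetric] sum_distrib_left diff_divide_distrib[symmetric])
  then show ?case using eq uv by simp
qed

text \<open>Induction on the number of points: after a modulation, the derivative in
  \<open>s\<close> is, up to a factor of modulus 1, a divided difference with one point fewer. The
  factor \<open>1 / (card Y - 1)!\<close> of the sharp bound is given up, since only the order in
  \<open>s\<close> matters.\<close>

lemma divided_difference_exp_bound:
  assumes "finite Y" "Y \<noteq> {}"
  shows "cmod (divided_difference Y (\<lambda>y. exp (- (\<i> * complex_of_real (y * s))))) \<le> \<bar>s\<bar> ^ (card Y - 1)"
  using assms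
proof (induction "card Y" arbitrary: Y s rule: less_induct)
  case less
  obtain u where u: "u \<in> Y" using less.prems by auto
  define E where "E = (\<lambda>t y. exp (- (\<i> * complex_of_real (y * t))))"
  show ?case
  proof (cases "Y = {u}")
    case True
    then show ?thesis by (simp add: divided_difference_def norm_exp_eq_Re)
  next
    case False
    then have c: "2 \<le> card Y" using less.prems u
      by (metis One_nat_def Suc_1 Suc_leI card_1_singletonE card_gt_0_iff le_neq_implies_less singletonD)
    define w where "w = (\<lambda>y. complex_of_real (\<Prod>z\<in>Y - {y}. y - z))"
    \<comment> \<open>Multiplying by \<open>exp(\<i> u s)\<close> before differentiating removes the point \<open>u\<close> from the divided difference.\<close>
    define g where "g = (\<lambda>t. \<Sum>y\<in>Y. exp (- (\<i> * complex_of_real (y - u) * complex_of_real t)) / w y)"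
    define g' where "g' = (\<lambda>t. \<Sum>y\<in>Y. - (\<i> * complex_of_real (y - u)) *
        exp (- (\<i> * complex_of_real (y - u) * complex_of_real t)) / w y)"
    have der: "(g has_vector_derivative g' t) (at t within S)" for t S
    proof -
      have "((\<lambda>z. \<Sum>y\<in>Y. exp (- (\<i> * complex_of_real (y - u) * z)) / w y) has_field_derivative g' t)
          (at (complex_of_real t))"
        unfolding g'_def
        by (auto intro!: derivative_eq_intros sum.cong simp: divide_inverse)
      then show ?thesis
        unfolding g_def by (intro has_vector_derivative_real_field)
    qed
    have split: "exp (- (\<i> * complex_of_real (y - u) * complex_of_real t))
        = exp (\<i> * complex_of_real (u * t)) * E t y" for y t
      unfolding E_def by (simp add: exp_add[symmetric] algebra_simps)
    have g: "g t = exp (\<i> * complex_of_real (u * t)) * divided_difference Y (E t)" for t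
      unfolding g_def divided_difference_def split w_def sum_distrib_left by simp
    have g': "g' t = - \<i> * exp (\<i> * complex_of_real (u * t)) * divided_difference (Y - {u}) (E t)" for t
      unfolding divided_difference_remove[OF less.prems(1) u]
      unfolding g'_def divided_difference_def split w_def sum_distrib_left by (simp add: mult_ac)
    have "cmod (g' t) \<le> \<bar>s\<bar> ^ (card Y - 2)" if "\<bar>t\<bar> \<le> \<bar>s\<bar>" for t
    proof -
      have "cmod (g' t) = cmod (divided_difference (Y - {u}) (E t))"
        by (simp add: g' norm_mult norm_exp_eq_Re)
      also have "\<dots> \<le> \<bar>t\<bar> ^ (card (Y - {u}) - 1)"
        unfolding E_def using less.prems u False c by (intro less.hyps) auto
      also have "\<dots> \<le> \<bar>s\<bar> ^ (card Y - 2)"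
        using that u less.prems by (simp add: power_mono numeral_2_eq_2)
      finally show ?thesis .
    qed
    \<comment> \<open>Mean value inequality for a complex-valued function; the closed segment covers
      both signs of \<open>s\<close>.\<close>
    then have "norm (g s - g 0) \<le> \<bar>s\<bar> ^ (card Y - 2) * norm (s - 0)"
      using der unfolding has_vector_derivative_def
      by (intro differentiable_bound[where S = "closed_segment 0 s" and f' = "\<lambda>t h. h *\<^sub>R g' t"] onorm_bound)
         (auto simp: closed_segment_eq_real_ivl mult.commute split: if_splits intro!: mult_left_mono)
    also have "\<dots> = \<bar>s\<bar> ^ (card Y - 1)"
      using c by (simp add: power_Suc2[symmetric] del: power_Suc power_Suc2) (simp add: numeral_2_eq_2 Suc_diff_Suc)
    \<comment> \<open>At \<open>s = 0\<close> all exponentials are 1, and divided differences of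
      constants vanish.\<close>
    also have "g 0 = 0"
      using divided_difference_const[OF less.prems(1) c] by (simp add: g E_def)
    finally show ?thesis
      by (simp add: g norm_mult norm_exp_eq_Re E_def)
  qed
qed

text \<open>Each denominator splits into the differences to the own family, with the point itself
  left out, and those to the other family. The auxiliary fact \<open>half\<close> is generic in the
  two families so that it serves twice, with the roles exchanged.\<close>

lemma divided_difference_Un_image:
  fixes x y :: "'i \<Rightarrow> real"
  assumes I: "finite I" and x: "inj_on x I" and y: "inj_on y I" and disj: "x ` I \<inter> y ` I = {}"
  shows "divided_difference (x ` I \<union> y ` I) f =
      (\<Sum>k\<in>I. f (x k) / complex_of_real ((\<Prod>j\<in>I - {k}. x k - x j) * (\<Prod>j\<in>I. x k - y j))) +
      (\<Sum>k\<in>I. f (y k) / complex_of_real ((\<Prod>j\<in>I - {k}. y k - y j) * (\<Prod>j\<in>I. y k - x j)))"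
proof -
  have half: "(\<Sum>t\<in>u ` I. f t / complex_of_real (\<Prod>z\<in>(u ` I \<union> v ` I) - {t}. t - z)) =
      (\<Sum>k\<in>I. f (u k) / complex_of_real ((\<Prod>j\<in>I - {k}. u k - u j) * (\<Prod>j\<in>I. u k - v j)))"
    if u: "inj_on u I" and v: "inj_on v I" and uv: "u ` I \<inter> v ` I = {}" for u v :: "'i \<Rightarrow> real"
  proof -
    have "(\<Prod>z\<in>(u ` I \<union> v ` I) - {u k}. u k - z) = (\<Prod>j\<in>I - {k}. u k - u j) * (\<Prod>j\<in>I. u k - v j)"
      if k: "k \<in> I" for k
    proof -
      have "u ` I \<union> v ` I - {u k} = u ` (I - {k}) \<union> v ` I"
        using k u uv by (auto simp: inj_on_def)
      moreover have "u ` (I - {k}) \<inter> v ` I = {}" using uv by auto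
      ultimately have "(\<Prod>z\<in>(u ` I \<union> v ` I) - {u k}. u k - z)
          = (\<Prod>z\<in>u ` (I - {k}). u k - z) * (\<Prod>z\<in>v ` I. u k - z)"
        using I by (simp add: prod.union_disjoint)
      also have "\<dots> = (\<Prod>j\<in>I - {k}. u k - u j) * (\<Prod>j\<in>I. u k - v j)"
        using u v by (simp add: prod.reindex inj_on_diff)
      finally show ?thesis .
    qed
    then show ?thesis using u by (simp add: sum.reindex del: of_real_mult of_real_prod)
  qed
  have "divided_difference (x ` I \<union> y ` I) f =
      (\<Sum>t\<in>x ` I. f t / complex_of_real (\<Prod>z\<in>(x ` I \<union> y ` I) - {t}. t - z)) +
      (\<Sum>t\<in>y ` I. f t / complex_of_real (\<Prod>z\<in>(x ` I \<union> y ` I) - {t}. t - z))"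
    unfolding divided_difference_def using I disj by (intro sum.union_disjoint) auto
  also have "(\<Sum>t\<in>x ` I. f t / complex_of_real (\<Prod>z\<in>(x ` I \<union> y ` I) - {t}. t - z)) =
      (\<Sum>k\<in>I. f (x k) / complex_of_real ((\<Prod>j\<in>I - {k}. x k - x j) * (\<Prod>j\<in>I. x k - y j)))"
    by (intro half x y disj)
  also have "(\<Sum>t\<in>y ` I. f t / complex_of_real (\<Prod>z\<in>(x ` I \<union> y ` I) - {t}. t - z)) =
      (\<Sum>k\<in>I. f (y k) / complex_of_real ((\<Prod>j\<in>I - {k}. y k - y j) * (\<Prod>j\<in>I. y k - x j)))"
    using half[OF y x] disj by (simp add: Un_commute Int_commute)
  finally show ?thesis .
qed

section \<open>Interlacing nodes with matching moments\<close>

text \<open>For integers \<open>j\<close> and \<open>k\<close> with \<open>j \<noteq> k\<close>, a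
  shift of \<open>k\<close> by 1/2 does not change the sign of \<open>k - j\<close>. This gives the
  sign of \<open>P\<close> at \<open>k + 1/2\<close> relative to \<open>P'(k)\<close>.\<close>

lemma half_grid_prod_pos:
  fixes k :: nat
  shows "0 < (\<Prod>j\<in>A - {k}. real k + 1 / 2 - real j) * (\<Prod>j\<in>A - {k}. real k - real j)"
proof -
  have "0 < (real k + 1 / 2 - real j) * (real k - real j)" if "j \<noteq> k" for j
  proof (cases "j < k")
    case True
    then show ?thesis by simp
  next
    case False
    then have "real k + 1 \<le> real j" using that by linarith
    then show ?thesis by (intro mult_neg_neg) auto
  qed
  then show ?thesis
    unfolding prod.distrib[symmetric] by (intro prod_pos) auto
qed

text \<open>The integer part of \<open>y k\<close> is \<open>k\<close>.\<close>

lemma interlaced_inj_on: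
  fixes y :: "nat \<Rightarrow> real"
  assumes y: "\<And>k. k < p \<Longrightarrow> real k < y k \<and> y k < real k + 1 / 2"
  shows "inj_on y {..<p}"
proof (rule inj_onI)
  fix i j assume "i \<in> {..<p}" "j \<in> {..<p}" "y i = y j"
  then have "real i < real j + 1" "real j < real i + 1"
    using y[of i] y[of j] by auto
  then show "i = j" by linarith
qed

text \<open>The product equation makes \<open>-1 / c\<close> the weight of every grid point
  \<open>k\<close> in the divided difference, so that a multiplication by \<open>c\<close> gives
  each grid point the amplitude -1.\<close>

lemma interlacing_nodes:
  assumes p: "2 \<le> p"
  obtains K v\<^sub>0 :: real where "0 < K" "0 < v\<^sub>0"
    "\<And>v. 0 < v \<Longrightarrow> v \<le> v\<^sub>0 \<Longrightarrow> \<exists>c y. 0 < c \<and> c \<le> K * v \<and> y 0 = v \<and>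
      (\<forall>k<p. real k < y k \<and> y k < real k + 1 / 2 \<and>
        (\<Prod>j\<in>{..<p} - {k}. real k - real j) * (\<Prod>j<p. real k - y j) = - c)"
proof -
  \<comment> \<open>For \<open>k < p\<close>, \<open>N k\<close> is \<open>P\<close> without its
    factor at \<open>k\<close>, and \<open>e k\<close> is \<open>P'(k)\<close>.\<close>
  define N where "N = (\<lambda>k. \<Prod>j\<in>{..<p} - {k}. [:- real j, 1:])"
  define e where "e = (\<lambda>k. \<Prod>j\<in>{..<p} - {k}. real k - real j)"
  define P where "P = (\<Prod>j<p. [:- real j, 1:])"
  \<comment> \<open>\<open>N k / e k\<close> is the Lagrange basis polynomial, so the prescribed
    value \<open>1 / e k\<close> gives the coefficient \<open>1 / (e k)^2\<close>.\<close>
  define R where "R = (\<Sum>k<p. smult (1 / (e k)\<^sup>2) (N k))"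
  have N: "poly (N k) x = (\<Prod>j\<in>{..<p} - {k}. x - real j)" for k x
    by (simp add: N_def poly_prod)
  have Ne: "poly (N k) (real k) = e k" for k by (simp add: N e_def)
  have e0: "e k \<noteq> 0" for k by (auto simp: e_def)
  have P: "P = [:- real k, 1:] * N k" if "k < p" for k
    unfolding P_def N_def using that by (intro prod.remove) auto
  have P_eval: "poly P t = (t - real k) * poly (N k) t" if "k < p" for k t
    by (simp add: P[OF that] algebra_simps)
  have R: "poly R (real k) = 1 / e k" if "k < p" for k
  proof -
    have "poly R (real k) = (\<Sum>i<p. if i = k then 1 / e k else 0)"
      unfolding R_def poly_sum
    proof (rule sum.cong)
      fix i assume "i \<in> {..<p}"
      show "poly (smult (1 / (e i)\<^sup>2) (N i)) (real k) = (if i = k then 1 / e k else 0)"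
      proof (cases "i = k")
        case True
        then show ?thesis using e0[of k] by (simp add: Ne power2_eq_square)
      next
        case False
        then have "poly (N i) (real k) = 0" using that by (auto simp: N)
        then show ?thesis using False by simp
      qed
    qed simp
    then show ?thesis using that by simp
  qed
  \<comment> \<open>Since \<open>P(v) = v * N 0 (v)\<close>, the polynomial \<open>P - c R\<close>
    has the root \<open>v\<close> for \<open>c = v * g v\<close>. The limit of \<open>g\<close> at 0
    is positive and finite, which makes \<open>c\<close> positive and of order
    \<open>v\<close>.\<close>
  define g where "g = (\<lambda>v. poly (N 0) v / poly R v)"
  have "isCont g 0"
    unfolding g_def using R[of 0] e0[of 0] p by (intro continuous_intros) auto
  moreover have "g 0 = (e 0)\<^sup>2"
    using R[of 0] p by (simp add: g_def N e_def power2_eq_square)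
  ultimately have g: "(g \<longlongrightarrow> (e 0)\<^sup>2) (at_right 0)"
    by (metis continuous_at_imp_continuous_at_within continuous_within)
  have ev_pos: "\<forall>\<^sub>F v in at_right 0. 0 < g v"
    using g e0[of 0] by (intro order_tendstoD) auto
  have ev_le: "\<forall>\<^sub>F v in at_right 0. g v < (e 0)\<^sup>2 + 1"
    using g by (intro order_tendstoD) auto
  \<comment> \<open>The bracket is \<open>Q(k + 1/2)\<close>. As \<open>v\<close> tends to 0 it
    tends to \<open>P(k + 1/2)\<close>, which has the sign of \<open>e k\<close>.\<close>
  have "\<forall>\<^sub>F v in at_right 0. 0 < (poly P (real k + 1/2) - v * g v * poly R (real k + 1/2)) * e k"
    if "k < p" for k
  proof (rule order_tendstoD)
    show "((\<lambda>v. (poly P (real k + 1/2) - v * g v * poly R (real k + 1/2)) * e k) \<longlongrightarrow>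
        (poly P (real k + 1/2) - 0 * (e 0)\<^sup>2 * poly R (real k + 1/2)) * e k) (at_right 0)"
      by (intro tendsto_intros g)
    show "0 < (poly P (real k + 1/2) - 0 * (e 0)\<^sup>2 * poly R (real k + 1/2)) * e k"
      using half_grid_prod_pos[of k "{..<p}"] by (simp add: P_eval[OF that] N e_def)
  qed
  then have "\<forall>\<^sub>F v in at_right 0. \<forall>k\<in>{..<p}. 0 < (poly P (real k + 1/2) - v * g v * poly R (real k + 1/2)) * e k"
    by (intro eventually_ball_finite) auto
  moreover have "\<forall>\<^sub>F v in at_right 0. v < (1/2 :: real)"
    by (intro order_tendstoD[OF tendsto_ident_at]) auto
  ultimately have "\<forall>\<^sub>F v in at_right 0. 0 < g v \<and> g v < (e 0)\<^sup>2 + 1 \<and> v < 1/2 \<and>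
      (\<forall>k<p. 0 < (poly P (real k + 1/2) - v * g v * poly R (real k + 1/2)) * e k)"
    using ev_pos ev_le by eventually_elim auto
  then obtain b where b: "0 < b" and small: "\<And>v. 0 < v \<Longrightarrow> v < b \<Longrightarrow>
      0 < g v \<and> g v < (e 0)\<^sup>2 + 1 \<and> v < 1/2 \<and>
      (\<forall>k<p. 0 < (poly P (real k + 1/2) - v * g v * poly R (real k + 1/2)) * e k)"
    unfolding eventually_at_right_field by blast
  \<comment> \<open>Halving \<open>b\<close> turns the open range \<open>v < b\<close> into a closed
    one.\<close>
  have main: "\<exists>c y. 0 < c \<and> c \<le> ((e 0)\<^sup>2 + 1) * v \<and> y 0 = v \<and>
      (\<forall>k<p. real k < y k \<and> y k < real k + 1 / 2 \<and> e k * (\<Prod>j<p. real k - y j) = - c)"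
    if v: "0 < v" "v \<le> b / 2" for v
  proof -
    have s: "0 < g v" "g v < (e 0)\<^sup>2 + 1" "v < 1/2"
      "\<And>k. k < p \<Longrightarrow> 0 < (poly P (real k + 1/2) - v * g v * poly R (real k + 1/2)) * e k"
      using small[of v] v b by auto
    define c where "c = v * g v"
    have c: "0 < c" "c \<le> ((e 0)\<^sup>2 + 1) * v"
      using s v by (auto simp: c_def mult.commute)
    define Q where "Q = P - smult c R"
    have Qk: "poly Q (real k) = - c / e k" if "k < p" for k
      using that by (simp add: Q_def R P_eval)
    have Qv: "poly Q v = 0"
    proof -
      have "poly R v \<noteq> 0" using s(1) by (auto simp: g_def)
      moreover have "0 < p" using p by simp
      ultimately show ?thesis by (simp add: Q_def c_def g_def P_eval[of 0])
    qed
    \<comment> \<open>\<open>Q(k) = -c / e k\<close> has the sign opposite to \<open>e k\<close>,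
      whereas \<open>Q(k + 1/2)\<close> has the same sign.\<close>
    have "\<exists>t. real k < t \<and> t < real k + 1/2 \<and> poly Q t = 0" if k: "k < p" for k
    proof -
      have "0 < poly Q (real k + 1/2) * e k" using s(4)[OF k] by (simp add: Q_def c_def)
      moreover have "0 < - poly Q (real k) * e k" using c e0[of k] Qk[OF k] by simp
      ultimately have "0 < (poly Q (real k + 1/2) * e k) * (- poly Q (real k) * e k)"
        by (rule mult_pos_pos)
      also have "\<dots> = - (poly Q (real k) * poly Q (real k + 1/2)) * (e k)\<^sup>2"
        by (simp add: power2_eq_square)
      finally have "poly Q (real k) * poly Q (real k + 1/2) < 0"
        using e0[of k] by (simp add: zero_less_mult_iff mult_less_0_iff)
      then show ?thesis
        using poly_IVT[of "real k" "real k + 1/2" Q] by auto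
    qed
    then obtain z where z: "\<And>k. k < p \<Longrightarrow> real k < z k \<and> z k < real k + 1/2 \<and> poly Q (z k) = 0"
      by metis
    \<comment> \<open>The intermediate value theorem does not say which root it finds in the first
      interval; the prescribed root \<open>v\<close> is put there.\<close>
    define y where "y = z(0 := v)"
    have y: "real k < y k" "y k < real k + 1/2" "poly Q (y k) = 0" if "k < p" for k
      using z[OF that] v s(3) Qv by (auto simp: y_def)
    have inj: "inj_on y {..<p}"
      using y by (intro interlaced_inj_on) auto
    have degN: "degree (N k) \<le> p - 1" if "k < p" for k
      using that unfolding N_def by (subst degree_prod_eq_sum_degree) auto
    have degR: "degree R \<le> p - 1"
      unfolding R_def using degN
      by (intro degree_sum_le) (auto intro: order.trans[OF degree_smult_le])
    have lin: "degree (\<Prod>j<p. [:- u j, 1:]) = p" "coeff (\<Prod>j<p. [:- u j, 1:]) p = 1" for u :: "nat \<Rightarrow> real"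
    proof -
      show d: "degree (\<Prod>j<p. [:- u j, 1:]) = p" by (subst degree_prod_eq_sum_degree) auto
      show "coeff (\<Prod>j<p. [:- u j, 1:]) p = 1"
        using lead_coeff_prod[of "\<lambda>j. [:- u j, 1:]" "{..<p}"] by (simp add: d)
    qed
    \<comment> \<open>Both sides are monic of degree \<open>p\<close>, because \<open>R\<close> has
      degree at most \<open>p - 1\<close>, and both vanish at the \<open>p\<close> distinct points
      \<open>y k\<close>.\<close>
    have "Q = (\<Prod>j<p. [:- y j, 1:])"
    proof (rule poly_eqI_degree_lead_coeff)
      show "coeff Q p = coeff (\<Prod>j<p. [:- y j, 1:]) p"
        using degR p lin(2) by (simp add: Q_def P_def coeff_eq_0)
      show "degree Q \<le> p"
        unfolding Q_def P_def using degR lin(1)[of real]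
        by (intro degree_diff_le) (auto intro: order.trans[OF degree_smult_le])
      show "p \<le> card (y ` {..<p})" using inj by (simp add: card_image)
      show "poly Q t = poly (\<Prod>j<p. [:- y j, 1:]) t" if "t \<in> y ` {..<p}" for t
        using that y(3) by (auto simp: poly_prod)
    qed (simp add: lin)
    then have "poly Q t = (\<Prod>j<p. t - y j)" for t by (simp add: poly_prod)
    then have "e k * (\<Prod>j<p. real k - y j) = - c" if "k < p" for k
      using Qk[OF that] e0[of k] by (simp add: field_simps)
    moreover have "y 0 = v" by (simp add: y_def)
    ultimately show ?thesis using c y by blast
  qed
  show ?thesis
    using that[of "(e 0)\<^sup>2 + 1" "b / 2"] b main unfolding e_def by (simp add: add_nonneg_pos)
qed

text \<open>The perturbation of the cluster in rescaled units, with step 1 and unit amplitudes. Both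
  the shift and the amplitude gain of the leftmost node are controlled from below by
  \<open>v\<close>.\<close>

lemma cluster_perturbation:
  assumes p: "2 \<le> p"
  obtains K v\<^sub>0 :: real where "0 < K" "0 < v\<^sub>0"
    "\<And>v. 0 < v \<Longrightarrow> v \<le> v\<^sub>0 \<Longrightarrow> \<exists>y b. y 0 = v \<and>
      (\<forall>k<p. real k < y k \<and> y k < real k + 1 / 2) \<and> 1 + v \<le> b 0 \<and>
      (\<forall>s. cmod ((\<Sum>k<p. complex_of_real (b k) * exp (- (\<i> * complex_of_real (y k * s)))) -
                 (\<Sum>k<p. exp (- (\<i> * complex_of_real (real k * s))))) \<le> K * v * \<bar>s\<bar> ^ (2 * p - 1))"
proof -
  obtain K v\<^sub>0 :: real where Kv: "0 < K" "0 < v\<^sub>0"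
    "\<And>v. 0 < v \<Longrightarrow> v \<le> v\<^sub>0 \<Longrightarrow> \<exists>c y. 0 < c \<and> c \<le> K * v \<and> y 0 = v \<and>
      (\<forall>k<p. real k < y k \<and> y k < real k + 1 / 2 \<and>
        (\<Prod>j\<in>{..<p} - {k}. real k - real j) * (\<Prod>j<p. real k - y j) = - c)"
    using interlacing_nodes[OF p] by metis
  show ?thesis
  proof (rule that[OF Kv(1,2)])
    fix v assume v: "0 < v" "v \<le> v\<^sub>0"
    then obtain c y where c: "0 < c" "c \<le> K * v" and y0: "y 0 = v"
      and y: "\<And>k. k < p \<Longrightarrow> real k < y k" "\<And>k. k < p \<Longrightarrow> y k < real k + 1 / 2"
      and prod: "\<And>k. k < p \<Longrightarrow> (\<Prod>j\<in>{..<p} - {k}. real k - real j) * (\<Prod>j<p. real k - y j) = - c"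
      using Kv(3)[of v] by metis
    \<comment> \<open>\<open>c\<close> times the weight of \<open>y k\<close> in the divided
      difference over both grids.\<close>
    define b where "b = (\<lambda>k. c / ((\<Prod>j\<in>{..<p} - {k}. y k - y j) * (\<Prod>j<p. y k - real j)))"
    define Y where "Y = real ` {..<p} \<union> y ` {..<p}"
    have inj: "inj_on y {..<p}"
      using y by (intro interlaced_inj_on) auto
    have disj: "real ` {..<p} \<inter> y ` {..<p} = {}"
    proof -
      have "real i \<noteq> y k" if "k < p" for i k
      proof
        assume "real i = y k"
        then have lt: "real k < real i" "real i < real k + 1" using y[OF that] by auto
        then have "real (Suc k) \<le> real i" unfolding of_nat_less_iff of_nat_le_iff by simp
        then show False using lt by simp
      qed
      then show ?thesis by auto
    qed
    have "0 \<in> {..<p}" using p by simp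
    then have Y: "finite Y" "Y \<noteq> {}" "card Y = 2 * p"
      using inj disj by (auto simp: Y_def card_Un_disjoint card_image)
    have dd: "complex_of_real c * divided_difference Y f =
        (\<Sum>k<p. complex_of_real (b k) * f (y k)) - (\<Sum>k<p. f (real k))" for f
    proof -
      have "divided_difference Y f = (\<Sum>k<p. f (real k) / complex_of_real (- c)) +
          (\<Sum>k<p. f (y k) / complex_of_real ((\<Prod>j\<in>{..<p} - {k}. y k - y j) * (\<Prod>j<p. y k - real j)))"
        unfolding Y_def using inj disj prod
        by (subst divided_difference_Un_image) (auto simp del: of_real_mult of_real_prod of_real_minus)
      then show ?thesis
        using c by (simp add: right_diff_distrib sum_distrib_left sum_negf b_def)
    qed
    have bound: "cmod ((\<Sum>k<p. complex_of_real (b k) * exp (- (\<i> * complex_of_real (y k * s)))) -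
        (\<Sum>k<p. exp (- (\<i> * complex_of_real (real k * s))))) \<le> K * v * \<bar>s\<bar> ^ (2 * p - 1)" for s
    proof -
      let ?f = "\<lambda>y. exp (- (\<i> * complex_of_real (y * s)))"
      have "cmod (complex_of_real c * divided_difference Y ?f) \<le> K * v * \<bar>s\<bar> ^ (2 * p - 1)"
        unfolding norm_mult
        using c divided_difference_exp_bound[OF Y(1,2), of s] Y(3) by (intro mult_mono) auto
      then show ?thesis
        unfolding \<open>\<And>f. complex_of_real c * divided_difference Y f = _ f\<close> .
    qed
    \<comment> \<open>Eliminating \<open>c\<close> by \<open>prod\<close> at \<open>k = 0\<close>
      writes \<open>b 0\<close> as a product of ratios: the distance of another point to 0 over its
      distance to \<open>v\<close>. No ratio is below 1, as \<open>v\<close> lies between 0 and all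
      these points. The grid point 1, present because \<open>2 \<le> p\<close>, yields
      \<open>1 / (1 - v) \<ge> 1 + v\<close>.\<close>
    have "1 + v \<le> b 0"
    proof -
      define J where "J = {..<p} - {0}"
      have v1: "v < 1" using y(2)[of 0] y0 p by auto
      have J: "1 \<le> real j" "real j < y j" if "j \<in> J" for j
        using that y[of j] by (auto simp: J_def)
      have split: "(\<Prod>j<p. u j) = u 0 * (\<Prod>j\<in>J. u j)" for u :: "nat \<Rightarrow> real"
        unfolding J_def using p by (intro prod.remove) auto
      have "c = v * ((\<Prod>j\<in>J. - real j) * (\<Prod>j\<in>J. - y j))"
        using prod[of 0] p y0 by (simp add: split J_def[symmetric] mult_ac)
      then have "b 0 = ((\<Prod>j\<in>J. - real j) * (\<Prod>j\<in>J. - y j)) / ((\<Prod>j\<in>J. v - real j) * (\<Prod>j\<in>J. v - y j))"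
        using v by (simp add: b_def split J_def[symmetric] y0 mult_ac)
      also have "\<dots> = (\<Prod>j\<in>J. (real j / (real j - v)) * (y j / (y j - v)))"
        unfolding prod.distrib[symmetric] prod_dividef[symmetric]
        using J v1 by (intro prod.cong refl) (simp add: divide_simps, force simp: algebra_simps)
      also have "\<dots> = (1 / (1 - v)) * (y 1 / (y 1 - v)) *
          (\<Prod>j\<in>J - {1}. (real j / (real j - v)) * (y j / (y j - v)))"
        using p by (subst prod.remove[of _ 1]) (auto simp: J_def)
      also have "\<dots> \<ge> (1 + v) * 1 * 1"
      proof (intro mult_mono)
        show "1 + v \<le> 1 / (1 - v)" using v1 by (simp add: field_simps)
        show "1 \<le> y 1 / (y 1 - v)" using J[of 1] p v v1 by (auto simp: J_def)
        have "1 \<le> real j / (real j - v) * (y j / (y j - v))" if "j \<in> J - {1}" for j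
        proof -
          have "1 * 1 \<le> real j / (real j - v) * (y j / (y j - v))"
            using J[of j] that v v1 by (intro mult_mono) auto
          then show ?thesis by simp
        qed
        then show "1 \<le> (\<Prod>j\<in>J - {1}. real j / (real j - v) * (y j / (y j - v)))"
          by (intro prod_ge_1) auto
      qed (use v v1 J[of 1] p in \<open>auto simp: J_def\<close>)
      finally show ?thesis by simp
    qed
    then show "\<exists>y b. y 0 = v \<and> (\<forall>k<p. real k < y k \<and> y k < real k + 1 / 2) \<and> 1 + v \<le> b 0 \<and>
      (\<forall>s. cmod ((\<Sum>k<p. complex_of_real (b k) * exp (- (\<i> * complex_of_real (y k * s)))) -
                 (\<Sum>k<p. exp (- (\<i> * complex_of_real (real k * s))))) \<le> K * v * \<bar>s\<bar> ^ (2 * p - 1))"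
      using y0 y bound by blast
  qed
qed

section \<open>Diameters of error sets and elementary changes of the Fourier transform\<close>

lemma ediam_ge: "v \<in> V \<Longrightarrow> w \<in> V \<Longrightarrow> ennreal (norm (v - w)) \<le> ediam V"
  unfolding ediam_def by (intro SUP_upper2[of "(v, w)"]) auto

lemma self_in_error_set: "F \<in> signals d \<Longrightarrow> 0 \<le> \<epsilon> \<Longrightarrow> F \<in> error_set d \<epsilon> \<Omega> F"
  by (simp add: error_set_def)

text \<open>\<open>F\<close> belongs to its own error set, so a single further element at distance
  \<open>D\<close> in the coordinate suffices.\<close>

lemma ediam_node_error_set_ge:
  assumes "F \<in> signals d" "0 \<le> \<epsilon>" "F' \<in> error_set d \<epsilon> \<Omega> F" "D \<le> \<bar>snd F' j - snd F j\<bar>"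
  shows "ennreal D \<le> ediam (node_error_set d \<epsilon> \<Omega> j F)"
proof -
  have "snd G j \<in> node_error_set d \<epsilon> \<Omega> j F" if "G \<in> error_set d \<epsilon> \<Omega> F" for G
    using that unfolding node_error_set_def by (cases G) auto
  then have "ennreal \<bar>snd F' j - snd F j\<bar> \<le> ediam (node_error_set d \<epsilon> \<Omega> j F)"
    using ediam_ge[of "snd F' j" _ "snd F j"] self_in_error_set[OF assms(1,2)] assms(3) by simp
  then show ?thesis using assms(4) ennreal_leI order.trans by blast
qed

lemma ediam_amplitude_error_set_ge:
  assumes "F \<in> signals d" "0 \<le> \<epsilon>" "F' \<in> error_set d \<epsilon> \<Omega> F" "D \<le> cmod (fst F' j - fst F j)"
  shows "ennreal D \<le> ediam (amplitude_error_set d \<epsilon> \<Omega> j F)"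
proof -
  have "fst G j \<in> amplitude_error_set d \<epsilon> \<Omega> j F" if "G \<in> error_set d \<epsilon> \<Omega> F" for G
    using that unfolding amplitude_error_set_def by (cases G) auto
  then have "ennreal (cmod (fst F' j - fst F j)) \<le> ediam (amplitude_error_set d \<epsilon> \<Omega> j F)"
    using ediam_ge[of "fst F' j" _ "fst F j"] self_in_error_set[OF assms(1,2)] assms(3) by simp
  then show ?thesis using assms(4) ennreal_leI order.trans by blast
qed

text \<open>Brings the Fourier kernel into the form of the divided difference bound.\<close>

lemma fourier_exp:
  "exp (- 2 * complex_of_real pi * \<i> * complex_of_real t * complex_of_real s)
    = exp (- (\<i> * complex_of_real (2 * pi * t * s)))"
  by (simp add: algebra_simps)

text \<open>Only one term changes, and the chord from 1 to a point of the unit circle is no longer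
  than the arc.\<close>

lemma fourier_node_upd:
  assumes "j \<in> {1..d}"
  shows "cmod (fourier d (a, x(j := x j + \<delta>)) s - fourier d (a, x) s) \<le> cmod (a j) * (2 * pi * \<bar>\<delta>\<bar> * \<bar>s\<bar>)"
proof -
  let ?e = "\<lambda>t. exp (- (\<i> * complex_of_real (2 * pi * t * s)))"
  have "fourier d (a, x(j := x j + \<delta>)) s - fourier d (a, x) s
      = (\<Sum>k=1..d. if k = j then a j * (?e (x j + \<delta>) - ?e (x j)) else 0)"
    unfolding fourier_def fourier_exp sum_subtractf[symmetric]
    by (intro sum.cong refl) (auto simp: right_diff_distrib)
  also have "\<dots> = a j * (?e (x j + \<delta>) - ?e (x j))" using assms by simp
  also have "?e (x j + \<delta>) - ?e (x j) = ?e (x j) * (exp (\<i> * complex_of_real (- (2 * pi * \<delta> * s))) - 1)"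
    by (simp add: algebra_simps exp_add[symmetric])
  also have "cmod (a j * \<dots>) = cmod (a j) * (2 * \<bar>sin (- (2 * pi * \<delta> * s) / 2)\<bar>)"
    unfolding norm_mult dist_exp_i_1 by (simp add: norm_exp_eq_Re)
  also have "\<dots> \<le> cmod (a j) * (2 * \<bar>- (2 * pi * \<delta> * s) / 2\<bar>)"
    by (intro mult_left_mono abs_sin_x_le_abs_x) auto
  also have "\<dots> = cmod (a j) * (2 * pi * \<bar>\<delta>\<bar> * \<bar>s\<bar>)" by (simp add: abs_mult)
  finally show ?thesis .
qed

lemma fourier_amplitude_upd:
  assumes "j \<in> {1..d}"
  shows "cmod (fourier d (a(j := a j + \<alpha>), x) s - fourier d (a, x) s) = cmod \<alpha>"
proof -
  let ?e = "\<lambda>t. exp (- (\<i> * complex_of_real (2 * pi * t * s)))"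
  have "fourier d (a(j := a j + \<alpha>), x) s - fourier d (a, x) s
      = (\<Sum>k=1..d. if k = j then \<alpha> * ?e (x j) else 0)"
    unfolding fourier_def fourier_exp sum_subtractf[symmetric]
    by (intro sum.cong refl) (auto simp: distrib_right)
  also have "\<dots> = \<alpha> * ?e (x j)" using assms by simp
  finally show ?thesis by (simp add: norm_mult norm_exp_eq_Re)
qed

text \<open>The terms outside the cluster cancel; the others are reindexed from 0 to match the
  rescaled grid.\<close>

lemma fourier_cluster_diff:
  assumes "1 \<le> \<kappa>" "\<kappa> + p \<le> d + 1"
    and "\<And>j. j \<in> {1..d} - {\<kappa>..<\<kappa> + p} \<Longrightarrow> fst F' j = fst F j \<and> snd F' j = snd F j"
  shows "fourier d F' s - fourier d F s =
    (\<Sum>k<p. fst F' (\<kappa> + k) * exp (- (\<i> * complex_of_real (2 * pi * snd F' (\<kappa> + k) * s)))) -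
    (\<Sum>k<p. fst F (\<kappa> + k) * exp (- (\<i> * complex_of_real (2 * pi * snd F (\<kappa> + k) * s))))"
proof -
  have split: "fourier d G s = (\<Sum>j\<in>{1..d} - {\<kappa>..<\<kappa> + p}. fst G j * exp (- (\<i> * complex_of_real (2 * pi * snd G j * s))))
      + (\<Sum>k<p. fst G (\<kappa> + k) * exp (- (\<i> * complex_of_real (2 * pi * snd G (\<kappa> + k) * s))))" for G
  proof -
    have "{\<kappa>..<\<kappa> + p} \<subseteq> {1..d}" using assms by auto
    then show ?thesis
      unfolding fourier_def fourier_exp
      by (subst sum.subset_diff[of "{\<kappa>..<\<kappa> + p}"])
        (auto simp: sum.atLeastLessThan_shift_0[of _ \<kappa>] atLeast0LessThan add.commute)
  qed
  show ?thesis unfolding split using assms(3) by simp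
qed

section \<open>The unperturbed node configuration\<close>

text \<open>Steps have length \<open>\<Delta>\<close> inside the cluster and \<open>g\<close>
  elsewhere. The origin is placed at the node \<open>\<kappa>\<close>, so that the cluster is
  exactly the grid \<open>0, \<Delta>, ..., (p - 1) \<Delta>\<close>.\<close>

definition cluster_grid :: "nat \<Rightarrow> nat \<Rightarrow> real \<Rightarrow> real \<Rightarrow> nat \<Rightarrow> real" where
  "cluster_grid \<kappa> p \<Delta> g j =
    (if j < \<kappa> then (real j - real \<kappa>) * g
     else if j < \<kappa> + p then (real j - real \<kappa>) * \<Delta>
     else (real p - 1) * \<Delta> + (real j - real \<kappa> - real p + 1) * g)"

lemma cluster_grid_Suc:
  assumes "1 \<le> p"
  shows "cluster_grid \<kappa> p \<Delta> g (Suc j)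
    = cluster_grid \<kappa> p \<Delta> g j + (if \<kappa> \<le> j \<and> Suc j < \<kappa> + p then \<Delta> else g)"
proof -
  consider "Suc j < \<kappa>" | "Suc j = \<kappa>" | "\<kappa> \<le> j" "Suc j < \<kappa> + p" | "Suc j = \<kappa> + p" | "\<kappa> + p \<le> j"
    by linarith
  then show ?thesis
  proof cases
    case 2
    then have "real \<kappa> = real j + 1" by linarith
    then show ?thesis using 2 assms by (auto simp: cluster_grid_def algebra_simps)
  next
    case 4
    then have j: "\<not> Suc j < \<kappa>" "\<not> Suc j < \<kappa> + p" "\<not> j < \<kappa>" "j < \<kappa> + p"
      and eq: "real j - real \<kappa> = real p - 1" using assms by linarith+
    have "cluster_grid \<kappa> p \<Delta> g (Suc j) = (real p - 1) * \<Delta> + ((real j - real \<kappa>) - (real p - 1) + 1) * g"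
      using j by (simp add: cluster_grid_def algebra_simps)
    also have "\<dots> = (real j - real \<kappa>) * \<Delta> + g" unfolding eq by simp
    finally show ?thesis using j by (simp add: cluster_grid_def)
  qed (auto simp: cluster_grid_def algebra_simps)
qed

text \<open>Unless both indices lie in the cluster, a long step occurs between them: either the
  first one after \<open>i\<close> or the one that leaves the cluster.\<close>

lemma cluster_grid_gap:
  assumes "1 \<le> p" "0 < \<Delta>" "\<Delta> \<le> g" "i < j"
  shows "cluster_grid \<kappa> p \<Delta> g i + (if i \<in> {\<kappa>..<\<kappa> + p} \<and> j \<in> {\<kappa>..<\<kappa> + p} then \<Delta> else g)
    \<le> cluster_grid \<kappa> p \<Delta> g j"
proof -
  let ?x = "cluster_grid \<kappa> p \<Delta> g"
  have mono: "?x u \<le> ?x v" if "u \<le> v" for u v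
    by (rule lift_Suc_mono_le[of ?x, OF _ that]) (use assms in \<open>simp add: cluster_grid_Suc\<close>)
  show ?thesis
  proof (cases "\<kappa> \<le> i \<and> Suc i < \<kappa> + p")
    case False
    then have "?x i + g = ?x (Suc i)" using assms by (auto simp: cluster_grid_Suc)
    also have "\<dots> \<le> ?x j" using assms by (intro mono) simp
    finally show ?thesis using False assms by auto
  next
    case True
    then have step: "?x i + \<Delta> = ?x (Suc i)" using assms by (simp add: cluster_grid_Suc)
    show ?thesis
    proof (cases "j < \<kappa> + p")
      case j: True
      have "?x (Suc i) \<le> ?x j" using assms by (intro mono) simp
      then show ?thesis using True j step assms by auto
    next
      case j: False
      have "?x i + g \<le> ?x (\<kappa> + p - 1) + g" using True by (intro add_right_mono mono) linarith
      also have "\<dots> = ?x (Suc (\<kappa> + p - 1))" using assms by (subst cluster_grid_Suc) auto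
      also have "\<dots> \<le> ?x j" using j assms by (intro mono) simp
      finally show ?thesis using j by auto
    qed
  qed
qed

text \<open>The extreme nodes are separated by \<open>p - 1\<close> short and \<open>d - p\<close>
  long steps.\<close>

lemma cluster_grid_diameter:
  assumes "1 \<le> p" "0 < \<Delta>" "\<Delta> \<le> g" "1 \<le> \<kappa>" "\<kappa> + p \<le> d + 1" "i \<in> {1..d}" "j \<in> {1..d}"
  shows "\<bar>cluster_grid \<kappa> p \<Delta> g i - cluster_grid \<kappa> p \<Delta> g j\<bar> \<le> (real p - 1) * \<Delta> + (real d - real p) * g"
proof -
  let ?x = "cluster_grid \<kappa> p \<Delta> g"
  have mono: "?x u \<le> ?x v" if "u \<le> v" for u v
    by (rule lift_Suc_mono_le[of ?x, OF _ that]) (use assms in \<open>simp add: cluster_grid_Suc\<close>)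
  have "?x d = (real p - 1) * \<Delta> + (real d - real \<kappa> - real p + 1) * g"
  proof (cases "d < \<kappa> + p")
    case True
    then have d: "d = \<kappa> + p - 1" "\<kappa> \<le> d" using assms by auto
    then have "real d = real \<kappa> + real p - 1" using assms by (simp add: of_nat_diff)
    then show ?thesis using True d(2) by (simp add: cluster_grid_def)
  next
    case False
    then show ?thesis by (auto simp: cluster_grid_def)
  qed
  moreover have "?x 1 = (1 - real \<kappa>) * g" using assms by (auto simp: cluster_grid_def)
  ultimately have "?x d - ?x 1 = (real p - 1) * \<Delta> + (real d - real p) * g"
    by (simp add: algebra_simps)
  moreover have "?x 1 \<le> ?x i" "?x i \<le> ?x d" "?x 1 \<le> ?x j" "?x j \<le> ?x d"
    using assms by (auto intro!: mono)
  ultimately show ?thesis by linarith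
qed

text \<open>The long step \<open>T / d\<close> exceeds \<open>\<eta> T\<close>. The cluster has
  length \<open>(p - 1) \<tau> h \<le> h \<le> T / d\<close>, so the whole grid has length at most
  \<open>(d + 1 - p) T / d \<le> T\<close>.\<close>

lemma cluster_grid_clustered_configuration:
  assumes \<tau>: "0 < \<tau>" "\<tau> \<le> 1" "\<tau> \<le> 1 / (real p - 1)" and \<eta>: "0 < \<eta>" "\<eta> \<le> 1" "\<eta> < 1 / real d"
    and p: "2 \<le> p" "1 \<le> \<kappa>" "\<kappa> + p \<le> d + 1" and h: "0 < h" "h \<le> T / real d"
  shows "clustered_configuration d p h T \<tau> \<eta> \<kappa> (restrict (cluster_grid \<kappa> p (\<tau> * h) (T / real d)) {1..d})"
proof -
  let ?x = "cluster_grid \<kappa> p (\<tau> * h) (T / real d)"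
  have d: "2 \<le> d" using p by auto
  have "h * real d \<le> T" using h d by (simp add: field_simps)
  moreover have "h * 1 \<le> h * real d" using h d by (intro mult_left_mono) auto
  ultimately have hT: "h \<le> T" by simp
  then have T: "0 < T" using h by simp
  have \<Delta>: "0 < \<tau> * h" "\<tau> * h \<le> h" "\<tau> * h \<le> T / real d" "(real p - 1) * (\<tau> * h) \<le> h"
  proof -
    show "0 < \<tau> * h" using \<tau> h by auto
    show "\<tau> * h \<le> h" using \<tau> h by auto
    then show "\<tau> * h \<le> T / real d" using h(2) by (rule order.trans)
    have "(real p - 1) * \<tau> \<le> 1" using \<tau> p by (simp add: field_simps)
    then have "(real p - 1) * \<tau> * h \<le> 1 * h" using h by (intro mult_right_mono) auto
    then show "(real p - 1) * (\<tau> * h) \<le> h" by (simp only: mult.assoc mult_1)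
  qed
  have gap: "?x i + (if i \<in> {\<kappa>..<\<kappa> + p} \<and> j \<in> {\<kappa>..<\<kappa> + p} then \<tau> * h else T / real d) \<le> ?x j"
    if "i < j" for i j
    using cluster_grid_gap[OF _ \<Delta>(1,3) that] p by auto
  have gap_abs: "(if i \<in> {\<kappa>..<\<kappa> + p} \<and> j \<in> {\<kappa>..<\<kappa> + p} then \<tau> * h else T / real d) \<le> \<bar>?x i - ?x j\<bar>"
    if "i \<noteq> j" for i j
    using gap[of i j] gap[of j i] that by (auto simp: neq_iff split: if_splits)
  have \<eta>T: "\<eta> * T \<le> T / real d"
    using mult_right_mono[of \<eta> "1 / real d" T] \<eta> T by simp
  have "(real p - 1) * (\<tau> * h) + (real d - real p) * (T / real d) \<le> T / real d + (real d - real p) * (T / real d)"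
    using order.trans[OF \<Delta>(4) h(2)] by (rule add_right_mono)
  also have "\<dots> = (real d + 1 - real p) * (T / real d)" by (simp only: left_diff_distrib distrib_right mult_1_left)
  also have "\<dots> \<le> real d * (T / real d)" using p T by (intro mult_right_mono) auto
  also have "\<dots> = T" using d by simp
  finally have total: "(real p - 1) * (\<tau> * h) + (real d - real p) * (T / real d) \<le> T" .
  have diam: "\<bar>?x i - ?x j\<bar> \<le> T" if "i \<in> {1..d}" "j \<in> {1..d}" for i j
    by (rule order.trans[OF cluster_grid_diameter[OF _ \<Delta>(1,3) p(2,3) that] total]) (use p in simp)
  have cluster: "\<bar>?x i - ?x j\<bar> \<le> h" if "i \<in> {\<kappa>..<\<kappa> + p}" "j \<in> {\<kappa>..<\<kappa> + p}" for i j
  proof -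
    have "?x i - ?x j = (real i - real j) * (\<tau> * h)"
      using that by (auto simp: cluster_grid_def algebra_simps)
    moreover have "\<bar>real i - real j\<bar> \<le> real p - 1"
    proof -
      have "i + 1 \<le> j + p" "j + 1 \<le> i + p" using that by auto
      then have "real i + 1 \<le> real j + real p" "real j + 1 \<le> real i + real p" by linarith+
      then show ?thesis by linarith
    qed
    then have "\<bar>real i - real j\<bar> * (\<tau> * h) \<le> (real p - 1) * (\<tau> * h)"
      using \<Delta> by (intro mult_right_mono) auto
    moreover have "\<bar>\<tau> * h\<bar> = \<tau> * h" using \<Delta>(1) by (rule abs_of_pos)
    ultimately show ?thesis using \<Delta>(4) by (simp only: abs_mult[of "real i - real j"])
  qed
  have "strict_mono_on {1..d} (restrict ?x {1..d})"
  proof (rule strict_mono_onI)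
    fix i j assume "i \<in> {1..d}" "j \<in> {1..d}" "i < j"
    then show "restrict ?x {1..d} i < restrict ?x {1..d} j"
      using gap[of i j] \<Delta>(1,3) by (simp split: if_splits)
  qed
  moreover have "\<tau> * h \<le> \<bar>?x i - ?x j\<bar>" if "i \<noteq> j" "i \<in> {\<kappa>..<\<kappa> + p}" "j \<in> {\<kappa>..<\<kappa> + p}" for i j
    using gap_abs[OF that(1)] that by auto
  moreover have "\<eta> * T \<le> \<bar>?x i - ?x j\<bar>" if "i \<noteq> j" "i \<notin> {\<kappa>..<\<kappa> + p}" for i j
    using gap_abs[OF that(1)] that \<eta>T by auto
  moreover have "{\<kappa>..<\<kappa> + p} \<subseteq> {1..d}" using p by auto
  ultimately show ?thesis
    unfolding clustered_configuration_def
    using \<tau> \<eta> p h hT diam cluster by (intro conjI ballI impI) (simp_all add: subset_iff)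
qed

section \<open>Choice of constants and the lower bounds\<close>

theorem theorem2p8:
  fixes d p :: nat and m M :: real
  assumes "0 < m" and "m \<le> M" and "2 \<le> p" and "p \<le> d"
  shows "\<exists>C\<^sub>1 C\<^sub>2 C\<^sub>3 C\<^sub>4 C\<^sub>5 :: real.
    0 < C\<^sub>1 \<and> 0 < C\<^sub>2 \<and> 0 < C\<^sub>3 \<and> 0 < C\<^sub>4 \<and> 0 < C\<^sub>5 \<and>
    (\<forall>(\<tau>::real) (\<eta>::real) (T::real) (\<kappa>::nat).
      0 < \<tau> \<and> \<tau> \<le> 1 \<and> \<tau> \<le> 1 / (real p - 1) \<and> 0 < \<eta> \<and> \<eta> \<le> 1 \<and> \<eta> < 1 / real d \<and> 0 < T \<and>
      \<kappa> \<in> {1..d - p + 1} \<longrightarrow>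
      (\<forall>(\<Omega>::real) (h::real). 0 < \<Omega> \<and> 0 < h \<and> h \<le> C\<^sub>4 * T \<and> \<Omega> * h \<le> C\<^sub>5 \<longrightarrow>
        (\<exists>F\<in>signals d.
          clustered_configuration d p h T \<tau> \<eta> \<kappa> (snd F) \<and>
          (\<forall>j\<in>{1..d}. m \<le> cmod (fst F j) \<and> cmod (fst F j) \<le> M) \<and>
          (\<exists>j\<^sub>1\<in>{\<kappa>..<\<kappa> + p}. \<exists>j\<^sub>2\<in>{\<kappa>..<\<kappa> + p}.
            \<forall>\<epsilon>::real. 0 < \<epsilon> \<and> \<epsilon> \<le> C\<^sub>3 * (\<Omega> * \<tau> * h) ^ (2 * p - 1) \<longrightarrow>
              ediam (node_error_set d \<epsilon> \<Omega> j\<^sub>1 F)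
                \<ge> ennreal (C\<^sub>1 / \<Omega> * \<epsilon> * (\<Omega> * \<tau> * h) powi (- 2 * int p + 2)) \<and>
              (\<forall>j\<in>{1..d} - {\<kappa>..<\<kappa> + p}.
                ediam (node_error_set d \<epsilon> \<Omega> j F) \<ge> ennreal (C\<^sub>1 / \<Omega> * \<epsilon>)) \<and>
              ediam (amplitude_error_set d \<epsilon> \<Omega> j\<^sub>2 F)
                \<ge> ennreal (C\<^sub>2 * \<epsilon> * (\<Omega> * \<tau> * h) powi (- 2 * int p + 1)) \<and>
              (\<forall>j\<in>{1..d} - {\<kappa>..<\<kappa> + p}.
                ediam (amplitude_error_set d \<epsilon> \<Omega> j F) \<ge> ennreal (C\<^sub>2 * \<epsilon>))))))"
proof -
  define q where "q = 2 * p - 1"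
  obtain K v\<^sub>0 :: real where K: "0 < K" "0 < v\<^sub>0"
    and pert: "\<And>v. 0 < v \<Longrightarrow> v \<le> v\<^sub>0 \<Longrightarrow> \<exists>y b. y 0 = v \<and>
      (\<forall>k<p. real k < y k \<and> y k < real k + 1 / 2) \<and> 1 + v \<le> b 0 \<and>
      (\<forall>s. cmod ((\<Sum>k<p. complex_of_real (b k) * exp (- (\<i> * complex_of_real (y k * s)))) -
                 (\<Sum>k<p. exp (- (\<i> * complex_of_real (real k * s))))) \<le> K * v * \<bar>s\<bar> ^ q)"
    by (rule cluster_perturbation[OF assms(3), folded q_def]) (rule that)
  \<comment> \<open>In original units \<open>|t| \<le> 2 pi \<rho>\<close>, so the cluster
    perturbation with parameter \<open>v\<close> changes the transform by at most
    \<open>v * B * \<rho> ^ q\<close>.\<close>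
  define B where "B = m * K * (2 * pi) ^ q"
  have B: "0 < B" using assms K by (simp add: B_def)
  \<comment> \<open>In each minimum the first entry serves the cluster and the second one the other
    nodes. In \<open>C\<^sub>3\<close> they guarantee \<open>v \<le> v\<^sub>0\<close> and a node
    shift of at most \<open>\<Delta> / 2\<close>.\<close>
  define C\<^sub>1 where "C\<^sub>1 = min (1 / B) (1 / (2 * pi * m))"
  define C\<^sub>2 where "C\<^sub>2 = min (m / B) 1"
  define C\<^sub>3 where "C\<^sub>3 = min (v\<^sub>0 * B) (pi * m)"
  have C: "0 < C\<^sub>1" "0 < C\<^sub>2" "0 < C\<^sub>3"
    using assms B K by (simp_all add: C\<^sub>1_def C\<^sub>2_def C\<^sub>3_def)
  \<comment> \<open>The value \<open>1 / d\<close> of the fourth constant makes room for the long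
    steps, and the value 1 of the fifth one gives \<open>\<rho> \<le> 1\<close>.\<close>
  show ?thesis
  proof (rule exI[of _ C\<^sub>1], rule exI[of _ C\<^sub>2], rule exI[of _ C\<^sub>3], rule exI[of _ "1 / real d"],
      rule exI[of _ 1], intro conjI allI impI C)
    show "0 < 1 / real d" using assms by simp
    show "0 < (1::real)" by simp
  next
    fix \<tau> \<eta> T :: real and \<kappa> :: nat and \<Omega> h :: real
    assume 1: "0 < \<tau> \<and> \<tau> \<le> 1 \<and> \<tau> \<le> 1 / (real p - 1) \<and> 0 < \<eta> \<and> \<eta> \<le> 1 \<and> \<eta> < 1 / real d \<and> 0 < T \<and>
      \<kappa> \<in> {1..d - p + 1}"
    assume 2: "0 < \<Omega> \<and> 0 < h \<and> h \<le> 1 / real d * T \<and> \<Omega> * h \<le> 1"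
    define \<Delta> where "\<Delta> = \<tau> * h"
    define \<rho> where "\<rho> = \<Omega> * \<tau> * h"
    define I where "I = {\<kappa>..<\<kappa> + p}"
    define x where "x = restrict (cluster_grid \<kappa> p \<Delta> (T / real d)) {1..d}"
    define a where "a = restrict (\<lambda>_. complex_of_real m) {1..d}"
    have \<kappa>: "1 \<le> \<kappa>" "\<kappa> + p \<le> d + 1" "I \<subseteq> {1..d}" "\<kappa> \<in> I"
      using 1 assms by (auto simp: I_def)
    have \<Delta>: "0 < \<Delta>" "\<Delta> \<le> T / real d"
    proof -
      show "0 < \<Delta>" using 1 2 by (simp add: \<Delta>_def)
      have "\<Delta> \<le> 1 * h" unfolding \<Delta>_def using 1 2 by (intro mult_right_mono) auto
      then show "\<Delta> \<le> T / real d" using 2 by simp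
    qed
    have \<rho>: "0 < \<rho>" "\<rho> \<le> 1" "\<rho> = \<Omega> * \<Delta>"
    proof -
      show "0 < \<rho>" using 1 2 by (simp add: \<rho>_def)
      have "\<tau> * (\<Omega> * h) \<le> 1 * 1" using 1 2 by (intro mult_mono) auto
      then show "\<rho> \<le> 1" by (simp add: \<rho>_def mult_ac)
    qed (simp add: \<rho>_def \<Delta>_def)
    have conf: "clustered_configuration d p h T \<tau> \<eta> \<kappa> x"
      unfolding x_def \<Delta>_def using 1 2 \<kappa> assms by (intro cluster_grid_clustered_configuration) auto
    have gap: "x i + \<Delta> \<le> x j" if "i < j" "i \<in> {1..d}" "j \<in> {1..d}" for i j
      using cluster_grid_gap[OF _ \<Delta> that(1), of p \<kappa>] \<Delta>(2) that(2,3) assms(3)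
      by (simp add: x_def split: if_splits)
    have x_cluster: "x (\<kappa> + k) = real k * \<Delta>" if "k < p" for k
      using that \<kappa> by (simp add: x_def cluster_grid_def)
    \<comment> \<open>All gaps are at least \<open>\<Delta>\<close>, so moving nodes to the right by
      less than \<open>\<Delta>\<close> preserves their order.\<close>
    have moved: "(a', x') \<in> signals d"
      if "a' \<in> {1..d} \<rightarrow>\<^sub>E UNIV" "x' \<in> {1..d} \<rightarrow>\<^sub>E UNIV"
        and "\<And>j. j \<in> {1..d} \<Longrightarrow> x j \<le> x' j \<and> x' j < x j + \<Delta>" for a' x'
    proof -
      have "strict_mono_on {1..d} x'"
      proof (rule strict_mono_onI)
        fix i j assume "i \<in> {1..d}" "j \<in> {1..d}" "i < j"
        then show "x' i < x' j" using that(3)[of i] that(3)[of j] gap[of i j] by linarith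
      qed
      then show ?thesis using that by (simp add: signals_def)
    qed
    have ext: "a \<in> {1..d} \<rightarrow>\<^sub>E UNIV" "x \<in> {1..d} \<rightarrow>\<^sub>E UNIV"
      by (simp_all add: a_def x_def)
    have F: "(a, x) \<in> signals d" using ext \<Delta> by (intro moved) auto
    have a: "a j = complex_of_real m" if "j \<in> {1..d}" for j using that by (simp add: a_def)
    have outer: "ennreal (C\<^sub>1 / \<Omega> * \<epsilon>) \<le> ediam (node_error_set d \<epsilon> \<Omega> j (a, x))"
      "ennreal (C\<^sub>2 * \<epsilon>) \<le> ediam (amplitude_error_set d \<epsilon> \<Omega> j (a, x))"
      if \<epsilon>: "0 < \<epsilon>" "\<epsilon> \<le> C\<^sub>3 * \<rho> ^ q" and j: "j \<in> {1..d}" for \<epsilon> j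
    proof -
      \<comment> \<open>The shift at which the bound \<open>m * 2 pi * \<delta> * \<Omega>\<close>
        for the change of the transform equals \<open>\<epsilon>\<close>.\<close>
      define \<delta> where "\<delta> = \<epsilon> / (2 * pi * m * \<Omega>)"
      have \<delta>: "0 < \<delta>" using \<epsilon> assms 2 by (simp add: \<delta>_def)
      have "\<epsilon> \<le> pi * m * \<rho>"
      proof -
        have "\<rho> ^ q \<le> \<rho> ^ 1" using \<rho> assms by (intro power_decreasing) (auto simp: q_def)
        then have "C\<^sub>3 * \<rho> ^ q \<le> (pi * m) * \<rho>"
          using \<rho> assms C by (intro mult_mono) (auto simp: C\<^sub>3_def)
        then show ?thesis using \<epsilon> by simp
      qed
      then have "\<delta> \<le> (pi * m * \<rho>) / (2 * pi * m * \<Omega>)"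
        unfolding \<delta>_def using assms 2 by (intro divide_right_mono) auto
      also have "\<dots> = \<Delta> / 2" using assms 2 by (simp add: \<rho>)
      finally have "\<delta> < \<Delta>" using \<Delta> by simp
      have "(a, x(j := x j + \<delta>)) \<in> error_set d \<epsilon> \<Omega> (a, x)"
        unfolding error_set_def
      proof (intro CollectI conjI ballI)
        show "(a, x(j := x j + \<delta>)) \<in> signals d"
          using ext j \<delta> \<open>\<delta> < \<Delta>\<close> \<Delta> by (intro moved) (auto simp: PiE_def extensional_def)
        fix s assume s: "s \<in> {-\<Omega>..\<Omega>}"
        have "cmod (fourier d (a, x(j := x j + \<delta>)) s - fourier d (a, x) s) \<le> cmod (a j) * (2 * pi * \<bar>\<delta>\<bar> * \<bar>s\<bar>)"
          using j by (rule fourier_node_upd)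
        also have "\<dots> \<le> m * (2 * pi * \<delta> * \<Omega>)"
          using a[OF j] assms \<delta> s by (auto intro!: mult_mono)
        also have "\<dots> = \<epsilon>" using assms 2 by (simp add: \<delta>_def)
        finally show "cmod (fourier d (a, x(j := x j + \<delta>)) s - fourier d (a, x) s) \<le> \<epsilon>" .
      qed
      moreover have "C\<^sub>1 / \<Omega> * \<epsilon> \<le> \<delta>"
      proof -
        have "C\<^sub>1 * (\<epsilon> / \<Omega>) \<le> (1 / (2 * pi * m)) * (\<epsilon> / \<Omega>)"
          using \<epsilon> 2 by (intro mult_right_mono) (auto simp: C\<^sub>1_def)
        then show ?thesis by (simp add: \<delta>_def)
      qed
      ultimately show "ennreal (C\<^sub>1 / \<Omega> * \<epsilon>) \<le> ediam (node_error_set d \<epsilon> \<Omega> j (a, x))"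
        using F \<epsilon> \<delta> by (intro ediam_node_error_set_ge[where F' = "(a, x(j := x j + \<delta>))"]) auto
      have "(a(j := a j + complex_of_real \<epsilon>), x) \<in> error_set d \<epsilon> \<Omega> (a, x)"
        unfolding error_set_def
      proof (intro CollectI conjI ballI)
        show "(a(j := a j + complex_of_real \<epsilon>), x) \<in> signals d"
          using ext j \<Delta> by (intro moved) (auto simp: PiE_def extensional_def)
        show "cmod (fourier d (a(j := a j + complex_of_real \<epsilon>), x) s - fourier d (a, x) s) \<le> \<epsilon>" for s
          using fourier_amplitude_upd[OF j] \<epsilon> by simp
      qed
      moreover have "C\<^sub>2 * \<epsilon> \<le> 1 * \<epsilon>"
        using \<epsilon> by (intro mult_right_mono) (auto simp: C\<^sub>2_def)
      ultimately show "ennreal (C\<^sub>2 * \<epsilon>) \<le> ediam (amplitude_error_set d \<epsilon> \<Omega> j (a, x))"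
        using F \<epsilon> by (intro ediam_amplitude_error_set_ge[where F' = "(a(j := a j + complex_of_real \<epsilon>), x)"]) auto
    qed
    have inner: "ennreal (C\<^sub>1 / \<Omega> * \<epsilon> * \<rho> powi (- 2 * int p + 2)) \<le> ediam (node_error_set d \<epsilon> \<Omega> \<kappa> (a, x))"
      "ennreal (C\<^sub>2 * \<epsilon> * \<rho> powi (- 2 * int p + 1)) \<le> ediam (amplitude_error_set d \<epsilon> \<Omega> \<kappa> (a, x))"
      if \<epsilon>: "0 < \<epsilon>" "\<epsilon> \<le> C\<^sub>3 * \<rho> ^ q" for \<epsilon>
    proof -
      \<comment> \<open>Chosen so that the bound \<open>v * B * \<rho> ^ q\<close> equals
        \<open>\<epsilon>\<close>.\<close>
      define v where "v = \<epsilon> / (B * \<rho> ^ q)"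
      have v: "0 < v" "v \<le> v\<^sub>0"
      proof -
        show "0 < v" using \<epsilon> B \<rho> by (simp add: v_def)
        have "C\<^sub>3 * \<rho> ^ q \<le> (v\<^sub>0 * B) * \<rho> ^ q" using \<rho> by (intro mult_right_mono) (auto simp: C\<^sub>3_def)
        then have "\<epsilon> \<le> v\<^sub>0 * (B * \<rho> ^ q)" using \<epsilon> by (simp add: mult.assoc)
        then show "v \<le> v\<^sub>0" using B \<rho> by (simp add: v_def divide_le_eq)
      qed
      obtain y b where y0: "y 0 = v" and y: "\<forall>k<p. real k < y k \<and> y k < real k + 1 / 2"
        and b0: "1 + v \<le> b 0"
        and diff: "\<forall>s. cmod ((\<Sum>k<p. complex_of_real (b k) * exp (- (\<i> * complex_of_real (y k * s)))) -
                 (\<Sum>k<p. exp (- (\<i> * complex_of_real (real k * s))))) \<le> K * v * \<bar>s\<bar> ^ q"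
        using pert[OF v] by (elim exE conjE) (rule that)
      define a' where "a' = (\<lambda>j. if j \<in> I then complex_of_real (m * b (j - \<kappa>)) else a j)"
      define x' where "x' = (\<lambda>j. if j \<in> I then y (j - \<kappa>) * \<Delta> else x j)"
      have shift: "x j \<le> x' j \<and> x' j < x j + \<Delta>" if "j \<in> {1..d}" for j
      proof (cases "j \<in> I")
        case True
        define k where "k = j - \<kappa>"
        have k: "j = \<kappa> + k" "k < p" using True by (auto simp: I_def k_def)
        have "real k * \<Delta> \<le> y k * \<Delta>" "y k * \<Delta> < (real k + 1) * \<Delta>"
          using y k(2) \<Delta> by (auto intro!: mult_right_mono mult_strict_right_mono)
        moreover have "x' j = y k * \<Delta>" using True by (simp add: x'_def k_def)
        ultimately show ?thesis using x_cluster[OF k(2)] k(1) by (simp add: distrib_right)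
      qed (use \<Delta> in \<open>simp add: x'_def\<close>)
      have "(a', x') \<in> error_set d \<epsilon> \<Omega> (a, x)"
        unfolding error_set_def
      proof (intro CollectI conjI ballI)
        show "(a', x') \<in> signals d"
          using ext \<kappa>(3) shift
          by (intro moved) (auto simp: PiE_def extensional_def a'_def x'_def)
        fix s assume s: "s \<in> {-\<Omega>..\<Omega>}"
        \<comment> \<open>The frequency in the units of the rescaled grid, including the factor
          \<open>2 pi\<close> of the transform.\<close>
        define t where "t = 2 * pi * \<Delta> * s"
        have "fourier d (a', x') s - fourier d (a, x) s =
          (\<Sum>k<p. a' (\<kappa> + k) * exp (- (\<i> * complex_of_real (2 * pi * x' (\<kappa> + k) * s)))) -
          (\<Sum>k<p. a (\<kappa> + k) * exp (- (\<i> * complex_of_real (2 * pi * x (\<kappa> + k) * s))))"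
          by (subst fourier_cluster_diff[OF \<kappa>(1,2)]) (auto simp: a'_def x'_def I_def)
        also have "(\<Sum>k<p. a' (\<kappa> + k) * exp (- (\<i> * complex_of_real (2 * pi * x' (\<kappa> + k) * s)))) =
            complex_of_real m * (\<Sum>k<p. complex_of_real (b k) * exp (- (\<i> * complex_of_real (y k * t))))"
          unfolding sum_distrib_left
          by (intro sum.cong refl) (simp add: a'_def x'_def I_def t_def mult_ac)
        also have "(\<Sum>k<p. a (\<kappa> + k) * exp (- (\<i> * complex_of_real (2 * pi * x (\<kappa> + k) * s)))) =
            complex_of_real m * (\<Sum>k<p. exp (- (\<i> * complex_of_real (real k * t))))"
          unfolding sum_distrib_left
        proof (intro sum.cong refl)
          fix k assume "k \<in> {..<p}"
          then have k: "k < p" "\<kappa> + k \<in> {1..d}" using \<kappa> by auto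
          show "a (\<kappa> + k) * exp (- (\<i> * complex_of_real (2 * pi * x (\<kappa> + k) * s))) =
              complex_of_real m * exp (- (\<i> * complex_of_real (real k * t)))"
            unfolding a[OF k(2)] x_cluster[OF k(1)] by (simp add: t_def mult_ac)
        qed
        finally have "cmod (fourier d (a', x') s - fourier d (a, x) s) =
          m * cmod ((\<Sum>k<p. complex_of_real (b k) * exp (- (\<i> * complex_of_real (y k * t)))) -
                 (\<Sum>k<p. exp (- (\<i> * complex_of_real (real k * t)))))"
          using assms(1) by (simp add: right_diff_distrib[symmetric] norm_mult)
        also have "\<dots> \<le> m * (K * v * \<bar>t\<bar> ^ q)"
          using assms by (intro mult_left_mono diff[rule_format]) auto
        also have "\<bar>t\<bar> \<le> 2 * pi * \<rho>"
          using s \<Delta> by (auto simp: t_def \<rho> abs_mult intro!: mult_left_mono)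
        then have "m * (K * v * \<bar>t\<bar> ^ q) \<le> m * (K * v * (2 * pi * \<rho>) ^ q)"
          using assms K v by (intro mult_left_mono power_mono) auto
        also have "\<dots> = v * (B * \<rho> ^ q)" by (simp add: B_def power_mult_distrib mult_ac)
        also have "\<dots> = \<epsilon>" using B \<rho>(1) by (simp add: v_def)
        finally show "cmod (fourier d (a', x') s - fourier d (a, x) s) \<le> \<epsilon>" by simp
      qed
      note ge = ediam_node_error_set_ge[OF F _ this] ediam_amplitude_error_set_ge[OF F _ this]
      have powi: "\<rho> powi (- 2 * int p + 2) = \<rho> / \<rho> ^ q" "\<rho> powi (- 2 * int p + 1) = 1 / \<rho> ^ q"
      proof -
        have "- 2 * int p + 1 = - int q" using assms by (simp add: q_def of_nat_diff)
        then show *: "\<rho> powi (- 2 * int p + 1) = 1 / \<rho> ^ q"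
          by (simp add: power_int_minus divide_inverse)
        have "\<rho> powi (- 2 * int p + 2) = \<rho> powi (- 2 * int p + 1) * \<rho>"
          using power_int_add_1[of \<rho> "- 2 * int p + 1"] \<rho>(1) by simp
        then show "\<rho> powi (- 2 * int p + 2) = \<rho> / \<rho> ^ q" unfolding * by simp
      qed
      \<comment> \<open>The node \<open>\<kappa>\<close> moves by \<open>v * \<Delta>\<close>, and
        \<open>\<Delta> = \<rho> / \<Omega>\<close> accounts for both the factor
        \<open>1 / \<Omega>\<close> and the exponent \<open>- 2 p + 2\<close>.\<close>
      have "C\<^sub>1 / \<Omega> * \<epsilon> * \<rho> powi (- 2 * int p + 2) = C\<^sub>1 * (\<epsilon> * \<Delta> / \<rho> ^ q)"
        using 2 unfolding powi by (simp add: \<rho>(3))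
      also have "\<dots> \<le> 1 / B * (\<epsilon> * \<Delta> / \<rho> ^ q)"
        using \<epsilon> \<Delta> \<rho> by (intro mult_right_mono) (auto simp: C\<^sub>1_def)
      also have "\<dots> = \<bar>x' \<kappa> - x \<kappa>\<bar>"
        using x_cluster[of 0] assms \<kappa>(4) y0 v(1) \<Delta>(1) by (simp add: x'_def) (simp add: v_def)
      finally show "ennreal (C\<^sub>1 / \<Omega> * \<epsilon> * \<rho> powi (- 2 * int p + 2)) \<le> ediam (node_error_set d \<epsilon> \<Omega> \<kappa> (a, x))"
        using \<epsilon> by (intro ge) auto
      have "C\<^sub>2 * \<epsilon> * \<rho> powi (- 2 * int p + 1) = C\<^sub>2 * (\<epsilon> / \<rho> ^ q)"
        unfolding powi by simp
      also have "\<dots> \<le> m / B * (\<epsilon> / \<rho> ^ q)"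
        using \<epsilon> \<rho> by (intro mult_right_mono) (auto simp: C\<^sub>2_def)
      also have "\<dots> = m * v" by (simp add: v_def)
      \<comment> \<open>The gain \<open>1 + v \<le> b 0\<close> at the leftmost node enters
        here.\<close>
      also have "\<dots> \<le> m * (b 0 - 1)" using assms b0 by (intro mult_left_mono) auto
      also have "\<dots> = cmod (a' \<kappa> - a \<kappa>)"
      proof -
        have "a' \<kappa> - a \<kappa> = complex_of_real (m * (b 0 - 1))"
          using \<kappa> a[of \<kappa>] by (auto simp: a'_def algebra_simps)
        then show ?thesis using assms b0 v by (simp only: norm_of_real) (simp add: abs_mult)
      qed
      finally show "ennreal (C\<^sub>2 * \<epsilon> * \<rho> powi (- 2 * int p + 1)) \<le> ediam (amplitude_error_set d \<epsilon> \<Omega> \<kappa> (a, x))"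
        using \<epsilon> by (intro ge) auto
    qed
    show "\<exists>F\<in>signals d.
          clustered_configuration d p h T \<tau> \<eta> \<kappa> (snd F) \<and>
          (\<forall>j\<in>{1..d}. m \<le> cmod (fst F j) \<and> cmod (fst F j) \<le> M) \<and>
          (\<exists>j\<^sub>1\<in>{\<kappa>..<\<kappa> + p}. \<exists>j\<^sub>2\<in>{\<kappa>..<\<kappa> + p}.
            \<forall>\<epsilon>::real. 0 < \<epsilon> \<and> \<epsilon> \<le> C\<^sub>3 * (\<Omega> * \<tau> * h) ^ (2 * p - 1) \<longrightarrow>
              ediam (node_error_set d \<epsilon> \<Omega> j\<^sub>1 F)
                \<ge> ennreal (C\<^sub>1 / \<Omega> * \<epsilon> * (\<Omega> * \<tau> * h) powi (- 2 * int p + 2)) \<and>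
              (\<forall>j\<in>{1..d} - {\<kappa>..<\<kappa> + p}.
                ediam (node_error_set d \<epsilon> \<Omega> j F) \<ge> ennreal (C\<^sub>1 / \<Omega> * \<epsilon>)) \<and>
              ediam (amplitude_error_set d \<epsilon> \<Omega> j\<^sub>2 F)
                \<ge> ennreal (C\<^sub>2 * \<epsilon> * (\<Omega> * \<tau> * h) powi (- 2 * int p + 1)) \<and>
              (\<forall>j\<in>{1..d} - {\<kappa>..<\<kappa> + p}.
                ediam (amplitude_error_set d \<epsilon> \<Omega> j F) \<ge> ennreal (C\<^sub>2 * \<epsilon>)))"
      \<comment> \<open>The leftmost cluster index \<open>\<kappa>\<close> serves as both
        \<open>j\<^sub>1\<close> and \<open>j\<^sub>2\<close>.\<close>
      unfolding \<rho>_def[symmetric] q_def[symmetric] I_def[symmetric]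
    proof (rule bexI[OF _ F], intro conjI)
      show "clustered_configuration d p h T \<tau> \<eta> \<kappa> (snd (a, x))" using conf by simp
      show "\<forall>j\<in>{1..d}. m \<le> cmod (fst (a, x) j) \<and> cmod (fst (a, x) j) \<le> M"
        using a assms by simp
    qed (rule bexI[OF _ \<kappa>(4)], rule bexI[OF _ \<kappa>(4)], intro allI impI conjI ballI inner outer, auto)
  qed
qed

end
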